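(* Let $m\ge 1$ be an integer and let $D$ be a $2$-strong digraph of order $n=2m+1\geq 3$. Then any two $T$-vertices $x$ and $y$ of $D$ lie on a common (directed) cycle of $D$.
   Context: Digraphs are finite, without loops and without multiple arcs (a pair of opposite arcs $xy$, $yx$ is allowed). For a vertex $x$, $d^+(x)$ and $d^-(x)$ denote its out-degree and in-degree. A digraph $D$ is strong if for every ordered pair of distinct vertices $u,v$ there is a directed path from $u$ to $v$; it is $k$-strong if $|V(D)|\ge k+1$ and deleting any set of fewer than $k$ vertices leaves a strong digraph. For a digraph $D$ of order $n=2m+1$, a $T$-vertex is a vertex $x$ with $d^+(x)\ge m$ and $d^-(x)\ge m$. *)

theory Defs
  imports "Graph_Theory.Digraph_Component"
begin

definition k_strong :: "nat \<Rightarrow> ('a, 'b) pre_digraph \<Rightarrow> bool" where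
  "k_strong k G \<longleftrightarrow>
     card (verts G) \<ge> k + 1 \<and>
     (\<forall>S \<subseteq> verts G. card S < k \<longrightarrow> strongly_connected (G \<restriction> (verts G - S)))"

text \<open>Defined only for digraphs of odd order; a digraph of even order has no such vertex.\<close>

definition T_vertex :: "('a, 'b) pre_digraph \<Rightarrow> 'a \<Rightarrow> bool" where
  "T_vertex G x \<longleftrightarrow>
     x \<in> verts G \<and>
     (\<exists>m. card (verts G) = 2 * m + 1 \<and> out_degree G x \<ge> m \<and> in_degree G x \<ge> m)"

text \<open>A cycle is a closed walk given by its list of arcs, so every vertex on it is the tail of
  one of its arcs.\<close>

definition on_cycle :: "('a, 'b) pre_digraph \<Rightarrow> 'b list \<Rightarrow> 'a \<Rightarrow> bool" where
  "on_cycle G p x \<longleftrightarrow> pre_digraph.cycle G p \<and> x \<in> tail G ` set p"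

end

theory Submission
  imports Defs
begin

text \<open>
  If \<open>x\<close> and \<open>y\<close> are adjacent, a path back closes the arc to a cycle. Otherwise all neighbourhoods of
  \<open>x\<close> and \<open>y\<close> lie in the \<open>2m - 1\<close> remaining vertices, so by counting there are \<open>z\<close> with
  \<open>y \<rightarrow> z \<rightarrow> x\<close> and \<open>u\<close> with \<open>x \<rightarrow> u \<rightarrow> y\<close>. If \<open>u \<noteq> z\<close> is possible, we have a 4-cycle. If not,
  the out-neighbours of \<open>x\<close> and the in-neighbours of \<open>y\<close> share only \<open>z\<close> and cover the remaining
  vertices. As \<open>D - z\<close> is strong, some arc \<open>a \<rightarrow> d\<close> leaves the set consisting of \<open>x\<close> and its
  out-neighbours in \<open>D - z\<close>, which gives the cycle \<open>x, a, d, y, z\<close>.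
\<close>

lemma (in nomulti_digraph) out_degree_eq_card:
  "out_degree G x = card {v. x \<rightarrow>\<^bsub>G\<^esub> v}"
proof -
  have "bij_betw (head G) (out_arcs G x) {v. x \<rightarrow>\<^bsub>G\<^esub> v}"
    by (auto simp: bij_betw_def inj_on_def arcs_ends_conv image_iff arc_to_ends_def
        intro: no_multi_arcs)
  then show ?thesis
    by (simp add: out_degree_def bij_betw_same_card)
qed

lemma (in nomulti_digraph) in_degree_eq_card:
  "in_degree G x = card {v. v \<rightarrow>\<^bsub>G\<^esub> x}"
proof -
  have "bij_betw (tail G) (in_arcs G x) {v. v \<rightarrow>\<^bsub>G\<^esub> x}"
    by (auto simp: bij_betw_def inj_on_def arcs_ends_conv image_iff arc_to_ends_def
        intro: no_multi_arcs)
  then show ?thesis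
    by (simp add: in_degree_def bij_betw_same_card)
qed

text \<open>A walk from inside \<open>X\<close> to outside has a first arc that crosses the
  boundary. This is how strong connectivity of a vertex-deleted subdigraph gets used.\<close>

lemma (in wf_digraph) reachable_imp_leaving_arc:
  assumes "u \<rightarrow>\<^sup>* v" and "u \<in> X" and "v \<notin> X"
  obtains a b where "a \<rightarrow> b" and "a \<in> X" and "b \<notin> X"
  using assms by (induction rule: converse_reachable_induct) blast+

lemma (in wf_digraph) on_cycle_if_arc:
  assumes "x \<rightarrow> y" and "y \<rightarrow>\<^sup>* x" and "x \<noteq> y"
  shows "\<exists>p. on_cycle G p x \<and> on_cycle G p y"
proof -
  obtain p where p: "apath y p x"
    using assms(2) reachable_apath by blast
  obtain e where e: "e \<in> arcs G" "tail G e = x" "head G e = y"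
    using assms(1) by blast
  obtain f q where f: "p = f # q" "tail G f = y"
    using p \<open>x \<noteq> y\<close> by (cases p) (auto simp: apath_def awalk_simps)
  have "awalk x (e # p) x"
    using p e by (auto simp: apath_def awalk_Cons_iff)
  \<comment> \<open>\<open>cycle\<close> wants distinctness only for the tail of the vertex list of
    \<open>e # p\<close>, and that tail is the vertex list of the path \<open>p\<close>.\<close>
  then have "cycle (e # p)"
    using p e unfolding cycle_def by (auto simp: apath_def)
  then show ?thesis
    using e f by (auto simp: on_cycle_def)
qed

lemma (in wf_digraph) on_4_cycle:
  assumes "x \<rightarrow> u" "u \<rightarrow> y" "y \<rightarrow> z" "z \<rightarrow> x" and "distinct [x, u, y, z]"
  shows "\<exists>p. on_cycle G p x \<and> on_cycle G p y"
proof -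
  obtain e1 e2 e3 e4 where e: "e1 \<in> arcs G" "tail G e1 = x" "head G e1 = u"
      "e2 \<in> arcs G" "tail G e2 = u" "head G e2 = y"
      "e3 \<in> arcs G" "tail G e3 = y" "head G e3 = z"
      "e4 \<in> arcs G" "tail G e4 = z" "head G e4 = x"
    using assms(1-4) by (auto elim!: reachableE)
  have "awalk x [e1, e2, e3, e4] x"
    using e by (auto simp: awalk_simps)
  then have "cycle [e1, e2, e3, e4]"
    using e assms(5) unfolding cycle_def by auto
  then show ?thesis
    using e by (auto simp: on_cycle_def intro!: exI[of _ "[e1, e2, e3, e4]"])
qed

lemma (in wf_digraph) on_5_cycle:
  assumes "x \<rightarrow> a" "a \<rightarrow> d" "d \<rightarrow> y" "y \<rightarrow> z" "z \<rightarrow> x" and "distinct [x, a, d, y, z]"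
  shows "\<exists>p. on_cycle G p x \<and> on_cycle G p y"
proof -
  obtain e1 e2 e3 e4 e5 where e: "e1 \<in> arcs G" "tail G e1 = x" "head G e1 = a"
      "e2 \<in> arcs G" "tail G e2 = a" "head G e2 = d"
      "e3 \<in> arcs G" "tail G e3 = d" "head G e3 = y"
      "e4 \<in> arcs G" "tail G e4 = y" "head G e4 = z"
      "e5 \<in> arcs G" "tail G e5 = z" "head G e5 = x"
    using assms(1-5) by (auto elim!: reachableE)
  have "awalk x [e1, e2, e3, e4, e5] x"
    using e by (auto simp: awalk_simps)
  then have "cycle [e1, e2, e3, e4, e5]"
    using e assms(6) unfolding cycle_def by auto
  then show ?thesis
    using e by (auto simp: on_cycle_def intro!: exI[of _ "[e1, e2, e3, e4, e5]"])
qed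

text \<open>Inclusion-exclusion: the union has at most \<open>card W\<close> elements, so at least
  one is counted twice; if only one is, the union already has \<open>card W\<close>
  elements.\<close>

lemma card_Un_Int_pigeonhole:
  assumes "finite W" "A \<subseteq> W" "B \<subseteq> W" "card W + 1 \<le> card A + card B"
  shows "A \<inter> B \<noteq> {}" and "A \<inter> B \<subseteq> {z} \<Longrightarrow> A \<union> B = W"
proof -
  have fin: "finite A" "finite B"
    using assms finite_subset by auto
  have sum: "card A + card B = card (A \<union> B) + card (A \<inter> B)"
    using fin by (rule card_Un_Int)
  have "card (A \<union> B) \<le> card W"
    using assms by (simp add: card_mono)
  then show "A \<inter> B \<noteq> {}"
    using sum assms(4) by auto
  assume "A \<inter> B \<subseteq> {z}"
  then have "card (A \<inter> B) \<le> 1"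
    using card_mono[of "{z}"] by auto
  then show "A \<union> B = W"
    using sum assms by (intro card_seteq) auto
qed

theorem theorem1:
  fixes D :: "('a, 'b) pre_digraph" and m :: nat and x y :: 'a
  assumes "digraph D"
    and "m \<ge> 1"
    and "card (verts D) = 2 * m + 1"
    and "k_strong 2 D"
    and "T_vertex D x" and "T_vertex D y" and "x \<noteq> y"
  shows "\<exists>p. on_cycle D p x \<and> on_cycle D p y"
proof -
  interpret digraph D by fact
  have xV: "x \<in> verts D" and yV: "y \<in> verts D"
    using assms(5,6) by (auto simp: T_vertex_def)
  have strong: "strongly_connected (D \<restriction> (verts D - S))" if "S \<subseteq> verts D" "card S < 2" for S
    using assms(4) that by (auto simp: k_strong_def)
  have "subgraph (D \<restriction> (verts D - {})) D"
    by (intro induced_imp_subgraph induced_induce) auto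
  moreover have "u \<rightarrow>\<^sup>*\<^bsub>D \<restriction> (verts D - {})\<^esub> v" if "u \<in> verts D" "v \<in> verts D" for u v
    using strong[of "{}"] that by (auto simp: strongly_connected_def)
  ultimately have reach: "u \<rightarrow>\<^sup>*\<^bsub>D\<^esub> v" if "u \<in> verts D" "v \<in> verts D" for u v
    using that reachable_mono by metis
  show ?thesis
  proof (cases "x \<rightarrow>\<^bsub>D\<^esub> y \<or> y \<rightarrow>\<^bsub>D\<^esub> x")
    case True
    then show ?thesis
      using on_cycle_if_arc reach xV yV assms(7) by metis
  next
    case False
    define W where "W = verts D - {x, y}"
    have finW: "finite W"
      by (simp add: W_def)
    \<comment> \<open>Two sets of at least \<open>m\<close> elements inside \<open>W\<close> thus
      meet the pigeonhole bound.\<close>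
    have cardW: "card W + 1 = 2 * m"
      using xV yV assms(2,3,7) by (simp add: W_def card_Diff_subset)
    define A where "A = {v. x \<rightarrow>\<^bsub>D\<^esub> v}"
    define B where "B = {v. v \<rightarrow>\<^bsub>D\<^esub> x}"
    define C where "C = {v. y \<rightarrow>\<^bsub>D\<^esub> v}"
    define E where "E = {v. v \<rightarrow>\<^bsub>D\<^esub> y}"
    have sub: "A \<subseteq> W" "B \<subseteq> W" "C \<subseteq> W" "E \<subseteq> W"
      using False adj_in_verts adj_not_same by (auto simp: A_def B_def C_def E_def W_def)
    have deg: "m \<le> card A" "m \<le> card B" "m \<le> card C" "m \<le> card E"
      using assms(3,5,6) out_degree_eq_card in_degree_eq_card
      by (auto simp: T_vertex_def A_def B_def C_def E_def)
    obtain z where z: "z \<in> C" "z \<in> B"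
      using card_Un_Int_pigeonhole(1)[of W C B] finW sub deg cardW by fastforce
    have zW: "z \<in> verts D" "z \<noteq> x" "z \<noteq> y"
      using z sub by (auto simp: W_def)
    show ?thesis
    proof (cases "A \<inter> E \<subseteq> {z}")
      case False
      then obtain u where "u \<in> A" "u \<in> E" "u \<noteq> z"
        by blast
      then show ?thesis
        using z zW assms(7) sub on_4_cycle[of x u y z]
        by (auto simp: A_def B_def C_def E_def W_def)
    next
      case True
      then have cover: "A \<union> E = W"
        using card_Un_Int_pigeonhole(2)[of W A E] finW sub deg cardW by simp
      let ?H = "D \<restriction> (verts D - {z})"
      interpret H: wf_digraph ?H
        by (rule wellformed_induce_subgraph)
      have "x \<rightarrow>\<^sup>*\<^bsub>?H\<^esub> y"
        using strong[of "{z}"] zW xV yV by (auto simp: strongly_connected_def)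
      moreover have "y \<notin> insert x (A - {z})"
        using assms(7) sub by (auto simp: W_def)
      ultimately obtain a d where ad: "a \<rightarrow>\<^bsub>?H\<^esub> d" "a \<in> insert x (A - {z})"
          "d \<notin> insert x (A - {z})"
        using H.reachable_imp_leaving_arc by blast
      have "a \<rightarrow>\<^bsub>D\<^esub> d" "d \<in> verts D" "d \<noteq> z"
        using ad(1) by (auto simp: arcs_ends_conv)
      \<comment> \<open>If \<open>a = x\<close>, then \<open>d\<close> would be an out-neighbour of
        \<open>x\<close> other than \<open>z\<close>, hence inside the set just left.\<close>
      moreover from this have "a \<in> A" "a \<noteq> z"
        using ad by (auto simp: A_def)
      \<comment> \<open>Otherwise \<open>a\<close> would lie in \<open>A \<inter> E\<close> and be
        \<open>z\<close>.\<close>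
      moreover have "d \<noteq> y"
        using calculation True by (auto simp: E_def)
      \<comment> \<open>Now \<open>d\<close> lies in \<open>W\<close> but not in \<open>A\<close>,
        so \<open>cover\<close> puts it into \<open>E\<close>.\<close>
      moreover have "d \<in> E"
        using calculation ad cover by (auto simp: W_def)
      ultimately show ?thesis
        using z zW assms(7) ad sub on_5_cycle[of x a d y z] adj_not_same
        by (auto simp: A_def B_def C_def E_def W_def)
    qed
  qed
qed

end
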